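(* Let $L$ and $M$ be locally compact frames and let $e\colon L\to L^\delta$ be a canonical extension of $L$. Then the monotone maps $\mathrm{pt}(L)\to\mathrm{pt}(M)$, with respect to the specialisation orders, are in a bijective correspondence with the frame homomorphisms $M\to L^\delta$.
   Context: The axiom of choice is assumed. A frame is a complete lattice in which finite meets distribute over arbitrary joins; frame homomorphisms preserve arbitrary joins and finite meets. For $a,c$ in a frame $L$, $c\ll a$ means: for every directed $D\subseteq L$, $a\le\bigvee D$ implies $c\le d$ for some $d\in D$. $L$ is locally compact if $a=\bigvee\{c\mid c\ll a\}$, a directed join, for every $a\in L$. A filter of $L$ is an upset closed under finite meets (the improper filter is allowed). A filter $\kappa\subseteq L$ is Scott-open if, whenever $D\subseteq L$ is directed and $\bigvee D\in\kappa$, then $d\in\kappa$ for some $d\in D$. $L^{\wedge}$ denotes the set of Scott-open filters of $L$, ordered by reverse inclusion. A canonical extension of a frame $L$ is a monotone map $e\colon L\to L^\delta$ into a complete lattice $L^\delta$ such that: (Dense) for all $u,v\in L^\delta$: $u\le v$ holds provided that for all $\kappa\in L^{\wedge}$ and $a\in L$, the inequalities $\bigwedge e[\kappa]\le u$ and $v\le e(a)$ together imply $\bigwedge e[\kappa]\le e(a)$; (Compact) if $\bigwedge e[\kappa]\le e(a)$ for some $\kappa\in L^{\wedge}$ and $a\in L$, then $a\in\kappa$. Every frame has a canonical extension, unique up to isomorphism; for locally compact $L$ the lattice $L^\delta$ is completely distributive, hence a frame. $\mathrm{pt}(L)$ is the space of frame homomorphisms $p\colon L\to\mathbf 2$ (two-element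 frame), with open sets $\{p\mid p(a)=1\}$ for $a\in L$. The specialisation order of a space $(X,\tau)$ is $x\le_\tau y$ iff every $U\in\tau$ containing $x$ contains $y$. *)

theory Defs
  imports "HOL-Analysis.Abstract_Topology" "HOL-Library.FuncSet"
begin

class frame = complete_lattice +
  assumes inf_Sup_frame: "inf a (Sup B) = (SUP b\<in>B. inf a b)"

instance bool :: frame
  by standard auto

text \<open>The codomain is only required to be a complete lattice, so that the notion applies to maps
  into a canonical extension. The empty finite meet is \<^const>\<open>top\<close>, the empty join \<^const>\<open>bot\<close>.\<close>

definition frame_hom :: "('a::complete_lattice \<Rightarrow> 'b::complete_lattice) \<Rightarrow> bool" where
  "frame_hom h \<longleftrightarrow>
     (\<forall>A. h (Sup A) = (SUP a\<in>A. h a)) \<and> h top = top \<and> (\<forall>a b. h (inf a b) = inf (h a) (h b))"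

text \<open>Directed sets are nonempty; otherwise the improper filter would never be Scott-open.\<close>

definition directed :: "'a::order set \<Rightarrow> bool" where
  "directed D \<longleftrightarrow> D \<noteq> {} \<and> (\<forall>x\<in>D. \<forall>y\<in>D. \<exists>z\<in>D. x \<le> z \<and> y \<le> z)"

definition way_below :: "'a::complete_lattice \<Rightarrow> 'a \<Rightarrow> bool" (infix "\<lless>" 50) where
  "c \<lless> a \<longleftrightarrow> (\<forall>D. directed D \<longrightarrow> a \<le> Sup D \<longrightarrow> (\<exists>d\<in>D. c \<le> d))"

definition locally_compact_frame :: "'a::frame itself \<Rightarrow> bool" where
  "locally_compact_frame _ \<longleftrightarrow> (\<forall>a::'a. directed {c. c \<lless> a} \<and> a = Sup {c. c \<lless> a})"

definition frame_filter :: "'a::frame set \<Rightarrow> bool" where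
  "frame_filter F \<longleftrightarrow>
     (\<forall>a\<in>F. \<forall>b. a \<le> b \<longrightarrow> b \<in> F) \<and> top \<in> F \<and> (\<forall>a\<in>F. \<forall>b\<in>F. inf a b \<in> F)"

definition scott_open_filter :: "'a::frame set \<Rightarrow> bool" where
  "scott_open_filter F \<longleftrightarrow>
     frame_filter F \<and> (\<forall>D. directed D \<longrightarrow> Sup D \<in> F \<longrightarrow> (\<exists>d\<in>D. d \<in> F))"

definition canonical_extension :: "('l::frame \<Rightarrow> 'd::complete_lattice) \<Rightarrow> bool" where
  "canonical_extension e \<longleftrightarrow>
     mono e \<and>
     (\<forall>u v. (\<forall>F a. scott_open_filter F \<longrightarrow> Inf (e ` F) \<le> u \<longrightarrow> v \<le> e a \<longrightarrow> Inf (e ` F) \<le> e a)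
        \<longrightarrow> u \<le> v) \<and>
     (\<forall>F a. scott_open_filter F \<longrightarrow> Inf (e ` F) \<le> e a \<longrightarrow> a \<in> F)"

text \<open>The points of a frame: homomorphisms into the two-element frame, which is \<^typ>\<open>bool\<close>. They
  form a set rather than a type, since a frame may have no points.\<close>

definition points :: "('l::frame \<Rightarrow> bool) set" where
  "points = {p. frame_hom p}"

definition pt :: "('l::frame \<Rightarrow> bool) topology" where
  "pt = topology (\<lambda>U. \<exists>a. U = {p \<in> points. p a})"

lemma openin_pt: "openin pt U \<longleftrightarrow> (\<exists>a. U = {p \<in> points. p a})"
proof -
  have "istopology (\<lambda>U. \<exists>a::'a. U = {p \<in> points. p a})"
    unfolding istopology_def
  proof (intro conjI allI impI)
    fix S T :: "('a \<Rightarrow> bool) set"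
    assume "\<exists>a. S = {p \<in> points. p a}" and "\<exists>a. T = {p \<in> points. p a}"
    then obtain a b where "S = {p \<in> points. p a}" and "T = {p \<in> points. p b}"
      by blast
    then have "S \<inter> T = {p \<in> points. p (inf a b)}"
      by (auto simp: points_def frame_hom_def)
    then show "\<exists>a. S \<inter> T = {p \<in> points. p a}" ..
  next
    fix K :: "('a \<Rightarrow> bool) set set"
    assume "\<forall>U\<in>K. \<exists>a. U = {p \<in> points. p a}"
    then obtain a where a: "\<And>U. U \<in> K \<Longrightarrow> U = {p \<in> points. p (a U)}"
      by metis
    have "\<Union>K = {p \<in> points. \<exists>U\<in>K. p (a U)}"
      using a by blast
    also have "\<dots> = {p \<in> points. p (Sup (a ` K))}"
      by (auto simp: points_def frame_hom_def)
    finally show "\<exists>a. \<Union>K = {p \<in> points. p a}" ..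
  qed
  then show ?thesis
    by (simp add: pt_def topology_inverse')
qed

lemma topspace_pt: "topspace pt = points"
proof -
  have "points = {p \<in> points. p (top::'a)}"
    by (auto simp: points_def frame_hom_def)
  then have "openin pt (points :: ('a \<Rightarrow> bool) set)"
    unfolding openin_pt by blast
  moreover have "topspace pt \<subseteq> (points :: ('a \<Rightarrow> bool) set)"
    unfolding topspace_def openin_pt by blast
  ultimately show ?thesis
    using openin_subset by blast
qed

definition spec_le :: "'a topology \<Rightarrow> 'a \<Rightarrow> 'a \<Rightarrow> bool" where
  "spec_le X x y \<longleftrightarrow> (\<forall>U. openin X U \<longrightarrow> x \<in> U \<longrightarrow> y \<in> U)"

text \<open>Maps between the carriers are extensional, i.e. they have a fixed junk value outside
  \<^term>\<open>topspace X\<close>, so that distinct elements of this set are distinct maps.\<close>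

definition spec_monotone_maps :: "'a topology \<Rightarrow> 'b topology \<Rightarrow> ('a \<Rightarrow> 'b) set" where
  "spec_monotone_maps X Y =
     {f \<in> topspace X \<rightarrow>\<^sub>E topspace Y. monotone_on (topspace X) (spec_le X) (spec_le Y) f}"

end

theory Submission
  imports Defs
begin

text \<open>A canonical extension \<open>e\<close> of \<open>L\<close> is, up to isomorphism, the inclusion of \<open>L\<close> into the lattice
  of upsets of \<open>pt(L)\<close>: an element \<open>u\<close> corresponds to the set of points \<open>p\<close> with
  \<open>\<And>e[F\<^sub>p] \<le> u\<close>, where \<open>F\<^sub>p\<close> is the completely prime filter of \<open>p\<close>. Density together with the
  separation of Scott-open filters by points makes this assignment an order embedding, compactness
  makes it onto. Finally, a homomorphism \<open>h\<close> from \<open>M\<close> into a lattice of upsets is the same as a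
  monotone map into \<open>pt(M)\<close>, by reading \<open>p \<in> h(m)\<close> as a function of \<open>p\<close>.\<close>

lemma inf_sup_frame:
  fixes a b c :: "'a::frame"
  shows "inf a (sup b c) = sup (inf a b) (inf a c)"
  using inf_Sup_frame[of a "{b, c}"] by simp

lemma sup_inf_frame:
  fixes a b c :: "'a::frame"
  shows "sup a (inf b c) = inf (sup a b) (sup a c)"
  by (rule distrib_imp1) (rule inf_sup_frame)

lemma frame_hom_bool:
  "frame_hom (p :: 'a::complete_lattice \<Rightarrow> bool) \<longleftrightarrow>
    (\<forall>A. p (Sup A) = (\<exists>a\<in>A. p a)) \<and> p top \<and> (\<forall>a b. p (inf a b) = (p a \<and> p b))"
  by (simp add: frame_hom_def)

lemma point_mono:
  assumes "p \<in> points" "p a" "a \<le> b"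
  shows "p b"
  using assms by (metis frame_hom_bool inf.absorb1 mem_Collect_eq points_def)

lemma scott_open_filter_point:
  assumes "p \<in> points"
  shows "scott_open_filter {a. p a}"
  using assms point_mono[OF assms]
  by (auto simp: scott_open_filter_def frame_filter_def points_def frame_hom_bool)

text \<open>Zorn's lemma applies because Scott-openness keeps the join of a nonempty chain (a
  directed set) outside \<open>F\<close>.\<close>

lemma scott_open_filter_maximal_avoiding:
  fixes F :: "'a::frame set"
  assumes F: "scott_open_filter F" and "a \<notin> F"
  obtains b where "a \<le> b" "b \<notin> F" "\<And>c. b \<le> c \<Longrightarrow> c \<notin> F \<Longrightarrow> c = b"
proof -
  let ?A = "{b. a \<le> b \<and> b \<notin> F}"
  have "\<exists>m\<in>?A. \<forall>c\<in>?A. m \<le> c \<longrightarrow> c = m"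
  proof (rule predicate_Zorn)
    show "partial_order_on ?A (relation_of (\<le>) ?A)"
      by (rule partial_order_on_relation_ofI) auto
    fix C assume "C \<in> Chains (relation_of (\<le>) ?A)"
    then have CA: "C \<subseteq> ?A" and chain: "\<And>x y. x \<in> C \<Longrightarrow> y \<in> C \<Longrightarrow> x \<le> y \<or> y \<le> x"
      unfolding Chains_def relation_of_def by blast+
    show "\<exists>u\<in>?A. \<forall>c\<in>C. c \<le> u"
    proof (cases "C = {}")
      case True
      \<comment> \<open>The empty chain is bounded by \<open>a\<close> itself.\<close>
      then show ?thesis using \<open>a \<notin> F\<close> by auto
    next
      case False
      then have "directed C"
        unfolding directed_def using chain by blast
      then have "Sup C \<notin> F"
        using F CA unfolding scott_open_filter_def by blast
      moreover have "a \<le> Sup C"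
        using False CA by (auto intro: Sup_upper2)
      ultimately show ?thesis
        by (auto intro: Sup_upper)
    qed
  qed
  then show ?thesis
    using that by (auto intro: order_trans)
qed

text \<open>An element \<open>b\<close> above \<open>a\<close> that is maximal outside
  \<open>F\<close> is prime, and the point sought is the one whose kernel is the principal ideal of
  \<open>b\<close>.\<close>

lemma scott_open_filter_separation:
  fixes F :: "'a::frame set"
  assumes F: "scott_open_filter F" and "a \<notin> F"
  obtains p where "p \<in> points" "\<And>x. x \<in> F \<Longrightarrow> p x" "\<not> p a"
proof -
  have up: "y \<in> F" if "x \<in> F" "x \<le> y" for x y
    using F that by (auto simp: scott_open_filter_def frame_filter_def)
  have "top \<in> F" and meet: "\<And>x y. x \<in> F \<Longrightarrow> y \<in> F \<Longrightarrow> inf x y \<in> F"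
    using F by (auto simp: scott_open_filter_def frame_filter_def)
  obtain b where b: "a \<le> b" "b \<notin> F" and max: "\<And>c. b \<le> c \<Longrightarrow> c \<notin> F \<Longrightarrow> c = b"
    using scott_open_filter_maximal_avoiding[OF assms] by blast
  have prime: "x \<le> b \<or> y \<le> b" if "inf x y \<le> b" for x y
  proof (rule ccontr)
    assume "\<not> ?thesis"
    \<comment> \<open>Both joins lie strictly above \<open>b\<close>, so maximality forces them into
      \<open>F\<close>. By distributivity their meet is \<open>sup b (inf x y)\<close>, which is
      \<open>b\<close>.\<close>
    then have "sup b x \<in> F" "sup b y \<in> F"
      using max by (metis sup_ge1 sup_ge2)+
    then have "sup b (inf x y) \<in> F"
      by (simp add: meet sup_inf_frame)
    then show False
      using that b by (simp add: sup_absorb1)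
  qed
  show ?thesis
  proof
    show "(\<lambda>x. \<not> x \<le> b) \<in> points"
      unfolding points_def mem_Collect_eq frame_hom_bool
    proof (intro conjI allI)
      show "(\<not> Sup A \<le> b) = (\<exists>x\<in>A. \<not> x \<le> b)" for A
        by (simp add: Sup_le_iff)
      show "\<not> top \<le> b"
        using \<open>top \<in> F\<close> b up by blast
      show "(\<not> inf x y \<le> b) = (\<not> x \<le> b \<and> \<not> y \<le> b)" for x y
        using prime by (auto intro: le_infI1 le_infI2)
    qed
  qed (use b up in auto)
qed

text \<open>Each element \<open>a\<close> gives the basic test "\<open>p a\<close> implies
  \<open>q a\<close>", and every open set of \<open>pt\<close> arises from such an
  \<open>a\<close>.\<close>

lemma spec_le_pt:
  assumes "p \<in> points" "q \<in> points"
  shows "spec_le pt p q \<longleftrightarrow> p \<le> q"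
  using assms by (auto simp: spec_le_def openin_pt le_fun_def)

definition point_upset :: "('l::frame \<Rightarrow> bool) set \<Rightarrow> bool" where
  "point_upset S \<longleftrightarrow> S \<subseteq> points \<and> (\<forall>p\<in>S. \<forall>q\<in>points. p \<le> q \<longrightarrow> q \<in> S)"

definition points_below :: "('l::frame \<Rightarrow> 'd::complete_lattice) \<Rightarrow> 'd \<Rightarrow> ('l \<Rightarrow> bool) set" where
  "points_below e u = {p \<in> points. Inf (e ` {a. p a}) \<le> u}"

lemma point_upset_points_below: "point_upset (points_below e u)"
proof -
  have "Inf (e ` {a. q a}) \<le> Inf (e ` {a. p a})" if "p \<le> q" for p q
    using that by (intro Inf_superset_mono image_mono) auto
  then show ?thesis
    unfolding point_upset_def points_below_def by (auto intro: order_trans)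
qed

text \<open>Density reduces \<open>u \<le> v\<close> to a Scott-open filter \<open>F\<close> and an
  element \<open>a\<close>. If \<open>a\<close> were outside \<open>F\<close>, a separating point
  \<open>p\<close> would belong to the set of \<open>u\<close>, hence to that of \<open>v\<close>,
  and compactness would yield \<open>p a\<close>.\<close>

lemma points_below_subset_iff:
  assumes "canonical_extension e"
  shows "points_below e u \<subseteq> points_below e v \<longleftrightarrow> u \<le> v"
proof
  assume sub: "points_below e u \<subseteq> points_below e v"
  have "Inf (e ` F) \<le> e a"
    if F: "scott_open_filter F" and Fu: "Inf (e ` F) \<le> u" and va: "v \<le> e a" for F a
  proof (cases "a \<in> F")
    case True
    then show ?thesis by (simp add: INF_lower)
  next
    case False
    then obtain p where p: "p \<in> points" "\<And>x. x \<in> F \<Longrightarrow> p x" "\<not> p a"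
      using scott_open_filter_separation[OF F] by blast
    \<comment> \<open>The filter of \<open>p\<close> contains \<open>F\<close>, so its meet is
      smaller.\<close>
    have "Inf (e ` {x. p x}) \<le> Inf (e ` F)"
      using p(2) by (intro Inf_superset_mono image_mono) auto
    then have "p \<in> points_below e u"
      using p(1) Fu by (simp add: points_below_def)
    then have "Inf (e ` {x. p x}) \<le> e a"
      using sub va by (auto simp: points_below_def)
    then have "p a"
      using assms scott_open_filter_point[OF p(1)] unfolding canonical_extension_def by blast
    with p(3) show ?thesis by contradiction
  qed
  then show "u \<le> v"
    using assms unfolding canonical_extension_def by blast
qed (auto simp: points_below_def)

lemma points_below_inj:
  assumes "canonical_extension e" "points_below e u = points_below e v"
  shows "u = v"
  using assms by (metis order_antisym order_refl points_below_subset_iff)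

text \<open>The join of the filter meets of the points in \<open>S\<close> is the witness;
  compactness prevents it from dominating the filter meet of any further point.\<close>

lemma points_below_surj:
  assumes e: "canonical_extension e" and S: "point_upset S"
  obtains u where "points_below e u = S"
proof
  let ?u = "SUP p\<in>S. Inf (e ` {a. p a})"
  show "points_below e ?u = S"
  proof
    show "S \<subseteq> points_below e ?u"
      using S by (auto simp: points_below_def point_upset_def intro: SUP_upper)
    show "points_below e ?u \<subseteq> S"
    proof (rule subsetI, rule ccontr)
      fix q assume "q \<in> points_below e ?u" and "q \<notin> S"
      then have q: "q \<in> points" "Inf (e ` {a. q a}) \<le> ?u"
        by (auto simp: points_below_def)
      \<comment> \<open>The largest element that \<open>q\<close> sends to 0. A point
        \<open>p\<close> fails \<open>p \<le> q\<close> as soon as some \<open>x\<close> has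
        \<open>p x\<close> but not \<open>q x\<close>, and then \<open>p ?b\<close>; thus
        \<open>e ?b\<close> bounds the whole join.\<close>
      let ?b = "Sup {x. \<not> q x}"
      have "\<not> q ?b"
        using q(1) by (simp add: points_def frame_hom_bool)
      have "Inf (e ` {a. p a}) \<le> e ?b" if "p \<in> S" for p
      proof -
        have "p \<in> points" "\<not> p \<le> q"
          using S that q(1) \<open>q \<notin> S\<close> by (auto simp: point_upset_def)
        then have "p ?b"
          by (auto simp: points_def frame_hom_bool le_fun_def)
        then show ?thesis by (simp add: INF_lower)
      qed
      then have "?u \<le> e ?b"
        by (rule SUP_least)
      then have "q ?b"
        using q e scott_open_filter_point[OF q(1)] order_trans
        unfolding canonical_extension_def by blast
      with \<open>\<not> q ?b\<close> show False ..
    qed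
  qed
qed

lemma points_below_top: "points_below e top = points"
  by (simp add: points_below_def)

lemma points_below_inf: "points_below e (inf u v) = points_below e u \<inter> points_below e v"
  by (auto simp: points_below_def)

text \<open>A union of upsets is an upset, hence the set of some \<open>w\<close> by surjectivity;
  order reflection makes \<open>w\<close> an upper bound of \<open>A\<close>.\<close>

lemma points_below_Sup:
  assumes e: "canonical_extension e"
  shows "points_below e (Sup A) = (\<Union>u\<in>A. points_below e u)"
proof
  have "point_upset (\<Union>u\<in>A. points_below e u)"
    using point_upset_points_below[of e] by (fastforce simp: point_upset_def)
  then obtain w where w: "points_below e w = (\<Union>u\<in>A. points_below e u)"
    using points_below_surj[OF e] by blast
  have "u \<le> w" if "u \<in> A" for u
    using that w points_below_subset_iff[OF e] by blast
  then have "Sup A \<le> w"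
    by (rule Sup_least)
  then show "points_below e (Sup A) \<subseteq> (\<Union>u\<in>A. points_below e u)"
    by (simp add: w[symmetric] points_below_subset_iff[OF e])
qed (auto simp: points_below_def intro: Sup_upper2)

text \<open>Since \<open>points_below e\<close> is injective and turns joins into unions and finite
  meets into intersections, the equations for \<open>h\<close> can be tested one point at a time. At
  a fixed \<open>p\<close> they are the equations of a homomorphism into
  \<open>bool\<close>.\<close>

lemma frame_hom_iff_points:
  fixes e :: "'l::frame \<Rightarrow> 'd::complete_lattice" and h :: "'m::frame \<Rightarrow> 'd"
  assumes e: "canonical_extension e"
  shows "frame_hom h \<longleftrightarrow> (\<forall>p\<in>points. (\<lambda>m. p \<in> points_below e (h m)) \<in> points)"
proof -
  have eq: "u = v \<longleftrightarrow> (\<forall>p\<in>points. p \<in> points_below e u \<longleftrightarrow> p \<in> points_below e v)" for u v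
  proof -
    have "points_below e u \<subseteq> points" "points_below e v \<subseteq> points"
      by (auto simp: points_below_def)
    then show ?thesis
      using points_below_inj[OF e] by blast
  qed
  show ?thesis
    unfolding frame_hom_def[of h] eq points_below_Sup[OF e] points_below_inf points_below_top
      points_def[where 'l='m] frame_hom_bool
    by auto
qed

theorem proposition7p1:
  fixes e :: "'l::frame \<Rightarrow> 'd::complete_lattice"
  assumes "locally_compact_frame TYPE('l)"
    and "locally_compact_frame TYPE('m::frame)"
    and "canonical_extension e"
  shows "\<exists>\<Phi>. bij_betw \<Phi>
    (spec_monotone_maps (pt :: ('l \<Rightarrow> bool) topology) (pt :: ('m \<Rightarrow> bool) topology))
    {h :: 'm \<Rightarrow> 'd. frame_hom h}"
proof -
  note e = assms(3)
  let ?maps = "spec_monotone_maps (pt :: ('l \<Rightarrow> bool) topology) (pt :: ('m \<Rightarrow> bool) topology)"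
  \<comment> \<open>The bijection is built from homomorphisms to maps and inverted at the end. It
    swaps the arguments of the relation "\<open>p\<close> lies in the upset of \<open>h m\<close>";
    restriction to \<open>points\<close> makes the result extensional.\<close>
  define \<Psi> :: "('m \<Rightarrow> 'd) \<Rightarrow> ('l \<Rightarrow> bool) \<Rightarrow> 'm \<Rightarrow> bool"
    where "\<Psi> h = (\<lambda>p\<in>points. \<lambda>m. p \<in> points_below e (h m))" for h
  have \<Psi>_apply: "\<Psi> h p m \<longleftrightarrow> p \<in> points_below e (h m)" if "p \<in> points" for h p m
    using that by (simp add: \<Psi>_def)
  have maps: "f \<in> ?maps \<longleftrightarrow> f \<in> points \<rightarrow>\<^sub>E points \<and> (\<forall>p\<in>points. \<forall>q\<in>points. p \<le> q \<longrightarrow> f p \<le> f q)"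
    for f
  proof (cases "f \<in> points \<rightarrow>\<^sub>E points")
    case True
    then have "spec_le pt (f p) (f q) \<longleftrightarrow> f p \<le> f q" if "p \<in> points" "q \<in> points" for p q
      by (intro spec_le_pt PiE_mem[OF True] that)
    then show ?thesis
      using True by (simp add: spec_monotone_maps_def topspace_pt monotone_on_def spec_le_pt)
  qed (simp add: spec_monotone_maps_def topspace_pt)
  have "bij_betw \<Psi> {h. frame_hom h} ?maps"
    unfolding bij_betw_def
  proof (intro conjI inj_onI subset_antisym subsetI)
    fix h k assume "\<Psi> h = \<Psi> k"
    then have "p \<in> points_below e (h m) \<longleftrightarrow> p \<in> points_below e (k m)" if "p \<in> points" for p m
      using that by (simp flip: \<Psi>_apply)
    then have "points_below e (h m) = points_below e (k m)" for m
      by (auto simp: points_below_def)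
    then show "h = k"
      by (intro ext points_below_inj[OF e])
  next
    fix f assume "f \<in> \<Psi> ` {h. frame_hom h}"
    then obtain h where h: "frame_hom h" and f: "f = \<Psi> h" by blast
    have "\<Psi> h p \<le> \<Psi> h q" if "p \<in> points" "q \<in> points" "p \<le> q" for p q
      using that point_upset_points_below[of e] by (auto simp: \<Psi>_def point_upset_def le_fun_def)
    then show "f \<in> ?maps"
      using h unfolding f maps frame_hom_iff_points[OF e] by (auto simp: \<Psi>_def)
  next
    fix f assume "f \<in> ?maps"
    then have f: "f \<in> points \<rightarrow>\<^sub>E points"
      and mono: "\<And>p q. p \<in> points \<Longrightarrow> q \<in> points \<Longrightarrow> p \<le> q \<Longrightarrow> f p \<le> f q"
      by (auto simp: maps)
    \<comment> \<open>Monotonicity of \<open>f\<close> enters here: it makes each such set an upset,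
      hence one represented by an element, which becomes \<open>h m\<close>.\<close>
    have "point_upset {p \<in> points. f p m}" for m
      using mono by (auto simp: point_upset_def le_fun_def)
    then have "\<exists>u. points_below e u = {p \<in> points. f p m}" for m
      by (rule points_below_surj[OF e]) blast
    then obtain h where h: "\<And>m. points_below e (h m) = {p \<in> points. f p m}"
      by metis
    have "frame_hom h"
      unfolding frame_hom_iff_points[OF e] h using f by (auto simp: PiE_mem)
    moreover have "\<Psi> h = f"
    proof
      show "\<Psi> h p = f p" for p
        \<comment> \<open>Outside \<open>points\<close> both sides are
          \<open>undefined\<close>.\<close>
        by (cases "p \<in> points") (simp_all add: \<Psi>_def h PiE_arb[OF f])
    qed
    ultimately show "f \<in> \<Psi> ` {h. frame_hom h}" by blast
  qed
  then show ?thesis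
    using bij_betw_inv by blast
qed

end
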